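(* Let $\Lambda\subseteq\mathbb{Z}_{\ge 0}\times\mathbb{Z}_{\ge 0}$ contain at least one $(s,d)$ with $d$ even. For each $n$, let $S_n$ be a uniform random subset of $[0,n]$. Then, for any real number $t$, $$\lim_{n\to\infty}\mathbb{P}\left(|S_n|<\frac{n+t\sqrt n}{2}\;\Big|\;\lambda(S_n)\in\Lambda\right)=\Phi(t),$$ where $\Phi$ is the standard normal (cumulative) distribution function.
   Context: $[0,n]$ denotes $\{0,1,\dots,n\}$. For a finite set $S$ of integers, $S+S=\{s_1+s_2 : s_1,s_2\in S\}$ and $S-S=\{s_1-s_2 : s_1,s_2\in S\}$. For $S\subseteq[0,n]$, $\lambda(S)=\lambda_n(S)=(2n+1-|S+S|,\;2n+1-|S-S|)$. Under the hypothesis on $\Lambda$, the probability $\mathbb{P}(\lambda(S_n)\in\Lambda)$ tends to a positive limit, so the conditional probability is defined for all large $n$. *)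

theory Defs
  imports "HOL-Probability.Probability" "HOL-Library.Set_Algebras"
begin

(* On sets, infix minus is set difference and infix plus (Set_Algebras) is the
   Minkowski sum. So S + S below is the sumset, whereas the difference set
   {s1 - s2} needs a constant of its own. *)
definition difference_set :: "int set \<Rightarrow> int set" where
  "difference_set S = {s1 - s2 | s1 s2. s1 \<in> S \<and> s2 \<in> S}"

(* The numbers of missing sums and missing differences of S within [0,n]. *)
definition missing :: "nat \<Rightarrow> int set \<Rightarrow> int \<times> int" where
  "missing n S =
     (2 * int n + 1 - int (card (S + S)), 2 * int n + 1 - int (card (difference_set S)))"

definition uniform_subset :: "nat \<Rightarrow> int set pmf" where
  "uniform_subset n = pmf_of_set (Pow {0..int n})"

end

theory Submission
  imports Defs "HOL-Real_Asymp.Real_Asymp"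
begin

text \<open>
  With probability close to 1, uniformly in \<open>n\<close>, all sums in \<open>[K, 2n - K]\<close> and all differences in
  \<open>[K - n, n - K]\<close> occur (a missing sum or difference means that a linear number of disjoint pairs
  is avoided). Then the numbers of missing sums and differences depend only on the fringe of \<open>S\<close>,
  its part within distance \<open>K\<close> of 0 or \<open>n\<close>. The fringe is independent of the middle part, which
  carries all but at most \<open>2 K\<close> elements of \<open>S\<close>, and the central limit theorem applies to the
  latter. Hence \<open>P(|S| small, \<lambda>(S) \<in> \<Lambda>) - \<Phi>(t) P(\<lambda>(S) \<in> \<Lambda>)\<close> tends to 0. It remains to bound
  \<open>P(\<lambda>(S) \<in> \<Lambda>)\<close> away from 0, for which one exhibits, for all \<open>s\<close> and all even \<open>d\<close>, fringes that miss
  exactly \<open>s\<close> sums and \<open>d\<close> differences.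
\<close>

subsection \<open>Sumsets and fringes\<close>

definition reflect :: "nat \<Rightarrow> int set \<Rightarrow> int set" where
  "reflect n S = (\<lambda>x. int n - x) ` S"

text \<open>The interval \<open>[p,q]\<close> is kept general because fullness is used both for
  \<open>[0,n]\<close> and for the shortened interval \<open>[m, n - m]\<close>. Nonnegative
  differences suffice, as a difference set is symmetric about 0.\<close>

definition full :: "int \<Rightarrow> int \<Rightarrow> int \<Rightarrow> int set \<Rightarrow> bool" where
  "full p q K S \<longleftrightarrow> {2 * p + K..2 * q - K} \<subseteq> S + S \<and> {0..q - p - K} \<subseteq> difference_set S"

definition gaps :: "int \<Rightarrow> int set \<Rightarrow> int set \<Rightarrow> int set" where
  "gaps K A B = {0..<K} - (A + B)"

text \<open>Reflection turns sums close to \<open>2 * n\<close> into small sums of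
  \<open>reflect n S\<close>, and differences close to \<open>n\<close> into small sums of
  \<open>S\<close> and \<open>reflect n S\<close>. The factor 2 accounts for the differences close
  to \<open>- n\<close>.\<close>

definition fringe_missing :: "nat \<Rightarrow> int \<Rightarrow> int set \<Rightarrow> int \<times> int" where
  "fringe_missing n K S =
     (int (card (gaps K S S)) + int (card (gaps K (reflect n S) (reflect n S))),
      2 * int (card (gaps K S (reflect n S))))"

lemma mem_reflect: "x \<in> reflect n S \<longleftrightarrow> int n - x \<in> S"
  by (force simp: reflect_def image_iff)

lemma mem_difference_set: "x \<in> difference_set S \<longleftrightarrow> (\<exists>a\<in>S. a + x \<in> S)"
  unfolding difference_set_def by (auto, metis diff_add_cancel add.commute, metis add_diff_cancel_left')

lemma mem_sumset: "x \<in> A + B \<longleftrightarrow> (\<exists>a\<in>A. x - a \<in> B)" for x :: int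
proof
  assume "\<exists>a\<in>A. x - a \<in> B"
  then obtain a where "a \<in> A" "x - a \<in> B" by blast
  then have "a + (x - a) \<in> A + B" by (rule set_plus_intro)
  then show "x \<in> A + B" by simp
qed (auto elim!: set_plus_elim intro: bexI[rotated])

lemma full_mono: "full p q K S \<Longrightarrow> S \<subseteq> T \<Longrightarrow> full p q K T"
  unfolding full_def subset_iff mem_sumset mem_difference_set by blast

lemma finite_gaps [simp]: "finite (gaps K A B)"
  by (simp add: gaps_def)

text \<open>When nonnegative integers add up to less than \<open>K\<close>, both summands lie below
  \<open>K\<close>.\<close>

lemma gaps_cong:
  assumes "A \<subseteq> {0..}" "A' \<subseteq> {0..}" "B \<subseteq> {0..}" "B' \<subseteq> {0..}"
    and "A \<inter> {0..<K} = A' \<inter> {0..<K}" "B \<inter> {0..<K} = B' \<inter> {0..<K}"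
  shows "gaps K A B = gaps K A' B'"
proof -
  have *: "x \<in> X + Y"
    if *: "x \<in> X' + Y'" "x < K" "X' \<subseteq> {0..}" "Y' \<subseteq> {0..}"
      "X \<inter> {0..<K} = X' \<inter> {0..<K}" "Y \<inter> {0..<K} = Y' \<inter> {0..<K}" for x X X' Y Y'
  proof -
    obtain a where a: "a \<in> X'" "x - a \<in> Y'" using *(1) unfolding mem_sumset by blast
    with * have "a \<in> X' \<inter> {0..<K}" "x - a \<in> Y' \<inter> {0..<K}" by fastforce+
    then show ?thesis using * unfolding mem_sumset by blast
  qed
  show ?thesis
    unfolding gaps_def
    using *[of _ A B A' B'] *[of _ A' B' A B] assms by auto
qed

text \<open>Fullness leaves room for missing sums only within \<open>K\<close> of the ends of
  \<open>[0, 2n]\<close>, and for missing differences only within \<open>K\<close> of the ends of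
  \<open>[-n, n]\<close>. Each end corresponds to a set of gaps after reflection, and
  \<open>K \<le> n\<close> keeps the two ends disjoint, so that cardinalities add.\<close>

lemma missing_eq_fringe_missing:
  assumes S: "S \<subseteq> {0..int n}" and K: "0 \<le> K" "K \<le> int n" and full: "full 0 (int n) K S"
  shows "missing n S = fringe_missing n K S"
proof -
  let ?R = "reflect n S"
  have S': "0 \<le> x \<and> x \<le> int n" if "x \<in> S" for x using S that by auto
  have "S + S \<subseteq> {0..2 * int n}" by (auto simp: mem_sumset dest!: S')
  then have "int (card ({0..2 * int n} - (S + S))) = 2 * int n + 1 - int (card (S + S))"
    using card_mono[of "{0..2 * int n}" "S + S"]
    by (subst card_Diff_subset) (auto intro: finite_subset)
  moreover have "{0..2 * int n} - (S + S) = gaps K S S \<union> (\<lambda>x. 2 * int n - x) ` gaps K ?R ?R"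
  proof -
    have R: "x \<in> ?R + ?R \<longleftrightarrow> 2 * int n - x \<in> S + S" for x
    proof -
      have "(\<exists>a\<in>?R. int n - x + a \<in> S) \<longleftrightarrow> (\<exists>b\<in>S. 2 * int n - x - b \<in> S)"
        by (auto simp: reflect_def algebra_simps)
      then show ?thesis by (simp add: mem_sumset mem_reflect algebra_simps)
    qed
    show ?thesis
    proof (rule set_eqI)
      fix x
      show "x \<in> {0..2 * int n} - (S + S) \<longleftrightarrow> x \<in> gaps K S S \<union> (\<lambda>x. 2 * int n - x) ` gaps K ?R ?R"
      proof (cases "x \<in> {K..2 * int n - K}")
        case True
        then have "x \<in> S + S" using full by (auto simp: full_def)
        then show ?thesis using True by (auto simp: gaps_def R)
      next
        case False
        have "x \<in> (\<lambda>x. 2 * int n - x) ` gaps K ?R ?R \<longleftrightarrow> 2 * int n - x \<in> gaps K ?R ?R"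
          by (force simp: image_iff)
        with False K show ?thesis by (auto simp: gaps_def R)
      qed
    qed
  qed
  moreover have "card (gaps K S S \<union> (\<lambda>x. 2 * int n - x) ` gaps K ?R ?R)
      = card (gaps K S S) + card (gaps K ?R ?R)"
    using K by (subst card_Un_disjoint) (auto simp: card_image inj_on_def gaps_def)
  ultimately have sums: "2 * int n + 1 - int (card (S + S))
      = int (card (gaps K S S)) + int (card (gaps K ?R ?R))" by simp

  have sym: "- x \<in> difference_set S \<longleftrightarrow> x \<in> difference_set S" for x
    unfolding mem_difference_set by (auto intro: bexI[where x = "a - x" for a] bexI[where x = "a + x" for a])
  have D: "difference_set S \<subseteq> {- int n..int n}" by (auto simp: mem_difference_set dest!: S')
  then have "int (card ({- int n..int n} - difference_set S)) = 2 * int n + 1 - int (card (difference_set S))"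
    using card_mono[of "{- int n..int n}" "difference_set S"]
    by (subst card_Diff_subset) (auto intro: finite_subset)
  moreover have "{- int n..int n} - difference_set S
      = (\<lambda>x. int n - x) ` gaps K S ?R \<union> (\<lambda>x. x - int n) ` gaps K S ?R"
  proof -
    have R: "x \<in> S + ?R \<longleftrightarrow> int n - x \<in> difference_set S" for x
      by (simp add: mem_sumset mem_reflect mem_difference_set algebra_simps)
    show ?thesis
    proof (rule set_eqI)
      fix x
      have 1: "x \<in> (\<lambda>x. int n - x) ` gaps K S ?R \<longleftrightarrow> int n - x \<in> gaps K S ?R"
        "x \<in> (\<lambda>x. x - int n) ` gaps K S ?R \<longleftrightarrow> int n + x \<in> gaps K S ?R"
        by (force simp: image_iff)+
      have 2: "x \<in> difference_set S" if "\<bar>x\<bar> \<le> int n - K"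
      proof -
        have "\<bar>x\<bar> \<in> difference_set S" using that full by (auto simp: full_def)
        then show ?thesis using sym[of x] by (cases "x \<ge> 0") auto
      qed
      show "x \<in> {- int n..int n} - difference_set S \<longleftrightarrow>
        x \<in> (\<lambda>x. int n - x) ` gaps K S ?R \<union> (\<lambda>x. x - int n) ` gaps K S ?R"
        unfolding Un_iff 1 using 2 K sym[of x] by (cases "\<bar>x\<bar> \<le> int n - K") (auto simp: gaps_def R)
    qed
  qed
  moreover have "card ((\<lambda>x. int n - x) ` gaps K S ?R \<union> (\<lambda>x. x - int n) ` gaps K S ?R)
      = 2 * card (gaps K S ?R)"
    using K by (subst card_Un_disjoint) (auto simp: card_image inj_on_def gaps_def)
  ultimately have "2 * int n + 1 - int (card (difference_set S)) = 2 * int (card (gaps K S ?R))" by simp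
  with sums show ?thesis by (simp add: missing_def fringe_missing_def)
qed

text \<open>Reflection carries \<open>(n - K, n]\<close> onto \<open>[0, K)\<close>, so all three
  sets of gaps see the fringe only. This is the source of the independence from the middle
  part.\<close>

lemma fringe_missing_cong:
  assumes "S \<subseteq> {0..int n}" "T \<subseteq> {0..int n}"
    and "S \<inter> ({0..<K} \<union> {int n - K<..int n}) = T \<inter> ({0..<K} \<union> {int n - K<..int n})"
  shows "fringe_missing n K S = fringe_missing n K T"
proof -
  have 1: "S \<inter> {0..<K} = T \<inter> {0..<K}" using assms(3) by blast
  have "x \<in> S \<longleftrightarrow> x \<in> T" if "x \<in> {int n - K<..int n}" for x using assms(3) that by blast
  then have 2: "reflect n S \<inter> {0..<K} = reflect n T \<inter> {0..<K}" by (auto simp: mem_reflect)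
  have 3: "S \<subseteq> {0..}" "T \<subseteq> {0..}" "reflect n S \<subseteq> {0..}" "reflect n T \<subseteq> {0..}"
    using assms(1,2) by (auto simp: reflect_def)
  show ?thesis unfolding fringe_missing_def
    using gaps_cong[OF 3(1,2,1,2) 1 1] gaps_cong[OF 3(3,4,3,4) 2 2] gaps_cong[OF 3(1,2,3,4) 1 2]
    by simp
qed

subsection \<open>Fringes with prescribed gaps\<close>

text \<open>The two ends of a subset of \<open>[0,n]\<close>, each read inwards from its end point, continued by full rays. The
  parameter \<open>s\<close> counts missing sums at both ends; \<open>e\<close> is half of the number of missing
  differences, since differences come in pairs \<open>\<plusminus>x\<close>.\<close>
definition fringe_pair :: "nat \<Rightarrow> nat \<Rightarrow> int set \<Rightarrow> int set \<Rightarrow> bool" where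
  "fringe_pair s e A B \<longleftrightarrow> A \<subseteq> {0..} \<and> B \<subseteq> {0..} \<and> (\<exists>m. {m..} \<subseteq> A \<and> {m..} \<subseteq> B) \<and>
     card ({0..} - (A + A)) + card ({0..} - (B + B)) = s \<and> card ({0..} - (A + B)) = e"

text \<open>Translating \<open>B\<close> by \<open>b\<close> moves the gaps of \<open>B + B\<close>
  and of \<open>A + B\<close> along and creates \<open>2 * b\<close> and \<open>b\<close> new ones
  at the start, while \<open>A + A\<close> is untouched.\<close>

lemma fringe_pair_shift:
  assumes "fringe_pair s e A B"
  shows "\<exists>B'. fringe_pair (s + 2 * b) (e + b) A B'"
proof -
  from assms obtain m where A: "A \<subseteq> {0..}" and B: "B \<subseteq> {0..}" and m: "{m..} \<subseteq> A" "{m..} \<subseteq> B"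
    and s: "card ({0..} - (A + A)) + card ({0..} - (B + B)) = s"
    and e: "card ({0..} - (A + B)) = e" unfolding fringe_pair_def by blast
  let ?C = "(\<lambda>x. x + int b) ` B"
  have C: "x \<in> ?C \<longleftrightarrow> x - int b \<in> B" for x by (force simp: image_iff)
  have fin: "finite ({0..} - (X + Y))" if "{m..} \<subseteq> X" "{m..} \<subseteq> Y" for X Y :: "int set"
  proof (rule finite_subset)
    show "{0..} - (X + Y) \<subseteq> {0..<2 * m}"
    proof
      fix x assume "x \<in> {0..} - (X + Y)"
      moreover have "x \<in> X + Y" if "x \<ge> 2 * m"
        unfolding mem_sumset using that \<open>{m..} \<subseteq> X\<close> \<open>{m..} \<subseteq> Y\<close>
        by (intro bexI[of _ m]) auto
      ultimately show "x \<in> {0..<2 * m}" by (cases "x \<ge> 2 * m") auto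
    qed
  qed simp
  have shift: "card ({0..} - Y) = card ({0..} - X) + c"
    if "X \<subseteq> {0..}" "finite ({0..} - X)" "\<And>x. x \<in> Y \<longleftrightarrow> x - int c \<in> X" for X Y c
  proof -
    have "{0..} - Y = {0..<int c} \<union> (\<lambda>x. x + int c) ` ({0..} - X)"
    proof (rule set_eqI)
      fix x
      have "x \<in> (\<lambda>x. x + int c) ` ({0..} - X) \<longleftrightarrow> x - int c \<in> {0..} - X"
        by (auto simp: image_iff intro: bexI[of _ "x - int c"])
      then show "x \<in> {0..} - Y \<longleftrightarrow> x \<in> {0..<int c} \<union> (\<lambda>x. x + int c) ` ({0..} - X)"
        using that(1) by (auto simp: that(3))
    qed
    also have "card \<dots> = c + card ({0..} - X)"
      using that(2) by (subst card_Un_disjoint) (auto simp: card_image)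
    finally show ?thesis by simp
  qed
  have 1: "x \<in> ?C + ?C \<longleftrightarrow> x - int (2 * b) \<in> B + B" for x
  proof -
    have "x \<in> ?C + ?C \<longleftrightarrow> (\<exists>a\<in>B. x - (a + int b) - int b \<in> B)"
      unfolding mem_sumset C by simp
    then show ?thesis by (simp add: mem_sumset algebra_simps)
  qed
  have 2: "x \<in> A + ?C \<longleftrightarrow> x - int b \<in> A + B" for x
    unfolding mem_sumset C by (simp add: algebra_simps)
  have pos: "X + Y \<subseteq> {0..}" if "X \<subseteq> {0..}" "Y \<subseteq> {0..}" for X Y :: "int set"
    using that by (fastforce elim!: set_plus_elim)
  have "card ({0..} - (?C + ?C)) = card ({0..} - (B + B)) + 2 * b"
    by (rule shift) (use 1 pos B fin m in auto)
  moreover have "card ({0..} - (A + ?C)) = card ({0..} - (A + B)) + b"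
    by (rule shift) (use 2 pos A B fin m in auto)
  moreover have "{m + int b..} \<subseteq> ?C" "{m + int b..} \<subseteq> A" using m by (auto simp: C subset_iff)
  moreover have "?C \<subseteq> {0..}" using B by auto
  ultimately have "fringe_pair (s + 2 * b) (e + b) A ?C"
    using A s e unfolding fringe_pair_def by auto
  then show ?thesis ..
qed

text \<open>Filling \<open>A\<close> and \<open>B\<close> from \<open>k\<close> on leaves exactly the gaps of \<open>A + B\<close> below \<open>k\<close>. As \<open>k\<close> grows
  their number increases in steps of at most one, so it takes every value.\<close>
lemma fringe_pair_truncate:
  fixes A B :: "int set"
  assumes AB: "A \<subseteq> {0..}" "B \<subseteq> {0..}" "0 \<in> A" "0 \<in> B"
    and inf: "infinite ({0..} - (A + B))"
    and k0: "{0..<k0} \<subseteq> A + B" "0 \<le> k0"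
    and s: "card ({0..<k0} - (A + A)) + card ({0..<k0} - (B + B)) = s"
    and full: "{k0..} \<subseteq> A + A" "{k0..} \<subseteq> B + B"
  shows "\<exists>A' B'. fringe_pair s e A' B'"
proof -
  let ?N = "\<lambda>k. {0..<int k} - (A + B)"
  have "\<exists>k. card (?N k) = e"
  proof -
    obtain X where X: "X \<subseteq> {0..} - (A + B)" "card X = e" "finite X"
      using inf by (meson infinite_arbitrarily_large)
    obtain M where M: "\<forall>x\<in>X. x \<le> M" using X(3) by (metis Max_ge)
    have "X \<subseteq> ?N (nat (M + 1))" using M X(1) by fastforce
    then have "e \<le> card (?N (nat (M + 1)))" using X by (metis card_mono finite_Diff finite_atLeastLessThan_int)
    have step: "card (?N (Suc k)) \<le> Suc (card (?N k))" for k
    proof -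
      have "?N (Suc k) \<subseteq> insert (int k) (?N k)" by auto
      then have "card (?N (Suc k)) \<le> card (insert (int k) (?N k))" by (intro card_mono) auto
      also have "\<dots> \<le> Suc (card (?N k))" by (rule card_insert_le_m1) auto
      finally show ?thesis .
    qed
    have "\<exists>k. card (?N k) = e" if "e \<le> card (?N M)" for M using that
    proof (induction M)
      case (Suc M)
      then show ?case using step[of M] by (cases "e \<le> card (?N M)") (auto intro: exI[of _ "Suc M"])
    qed (auto intro: exI[of _ 0])
    then show ?thesis using \<open>e \<le> card (?N (nat (M + 1)))\<close> by blast
  qed
  then obtain k' where k': "card (?N k') = e" ..
  \<comment> \<open>Filling must not start below \<open>k0\<close>, or it could close gaps of
    \<open>A + A\<close> and \<open>B + B\<close> that \<open>s\<close> counts. Raising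
    \<open>k'\<close> to \<open>k0\<close> adds no gap of \<open>A + B\<close>, which has none below
    \<open>k0\<close>.\<close>
  define k where "k = max (int k') k0"
  have ke: "card ({0..<k} - (A + B)) = e"
  proof (cases "int k' \<le> k0")
    case True
    then have "?N k' \<subseteq> {0..<k0} - (A + B)" by auto
    then have "?N k' = {}" using k0 by auto
    moreover have "{0..<k} - (A + B) = {}" using True k0 by (simp add: k_def)
    ultimately show ?thesis using k' by (metis card.empty)
  qed (use k' in \<open>simp add: k_def\<close>)
  define T where "T X = (X \<inter> {0..<k}) \<union> {k..}" for X :: "int set"
  have T: "X \<subseteq> T X" "T X \<subseteq> {0..}" if "X \<subseteq> {0..}" for X
    using that k0 by (auto simp: T_def k_def)
  \<comment> \<open>Above \<open>k\<close> the ray in \<open>T X\<close> together with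
    \<open>0 \<in> Y\<close> gives every sum; below \<open>k\<close> both summands are below
    \<open>k\<close>, where filling changes nothing.\<close>
  have *: "{0..} - (T X + T Y) = {0..<k} - (X + Y)" if "X \<subseteq> {0..}" "Y \<subseteq> {0..}" "0 \<in> Y" for X Y
  proof -
    have 1: "X + Y \<subseteq> T X + T Y" using T that by (intro set_plus_mono2)
    have 2: "x \<in> T X + T Y" if "x \<ge> k" for x
    proof -
      have "x \<in> T X" "x - x \<in> T Y" using \<open>x \<ge> k\<close> \<open>0 \<in> Y\<close> \<open>Y \<subseteq> {0..}\<close> T[of Y] by (auto simp: T_def)
      then show "x \<in> T X + T Y" unfolding mem_sumset by blast
    qed
    have 3: "x \<in> X + Y" if "x < k" "x \<in> T X + T Y" for x
    proof -
      from that obtain a where "a \<in> T X" "x - a \<in> T Y" by (auto simp: mem_sumset)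
      moreover have "a \<ge> 0" "x - a \<ge> 0" using calculation T \<open>X \<subseteq> {0..}\<close> \<open>Y \<subseteq> {0..}\<close> by (meson atLeast_iff subsetD)+
      ultimately have "a \<in> X" "x - a \<in> Y" using \<open>x < k\<close> by (auto simp: T_def)
      then show ?thesis by (auto simp: mem_sumset)
    qed
    show ?thesis
    proof (rule set_eqI)
      fix x show "x \<in> {0..} - (T X + T Y) \<longleftrightarrow> x \<in> {0..<k} - (X + Y)"
        using 1 2[of x] 3[of x] by (cases "x < k") auto
    qed
  qed
  have "{0..<k} - Z = {0..<k0} - Z" if "{k0..} \<subseteq> Z" for Z
  proof (rule set_eqI)
    fix x show "x \<in> {0..<k} - Z \<longleftrightarrow> x \<in> {0..<k0} - Z"
      using that by (cases "x < k0") (auto simp: k_def)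
  qed
  from this[OF full(1)] this[OF full(2)] have "fringe_pair s e (T A) (T B)"
    using AB T s ke unfolding fringe_pair_def by (simp add: *) (auto simp: T_def)
  then show ?thesis by blast
qed

section \<open>Fringes from additive bases modulo 10\<close>

definition residues :: "int set \<Rightarrow> int set" where
  "residues R = {x. x \<ge> 0 \<and> x mod 10 \<in> R}"

text \<open>The exceptional last digit \<open>c\<close> is one whose representation needs a carry; \<open>c = 10\<close> stands for none.\<close>
lemma mem_sum_residues:
  assumes "0 \<le> x"
    and "\<And>r. r \<in> {0, 1, 2, 3, 4, 5, 6, 7, 8, 9} \<Longrightarrow>
      \<exists>a\<in>R. 0 \<le> a \<and> a < 10 \<and> (a \<le> r \<or> r = c) \<and> (r - a) mod 10 \<in> R'"
    and "x mod 10 = c \<Longrightarrow> 10 \<le> x"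
  shows "x \<in> residues R + residues R'"
proof -
  have "x mod 10 = 0 \<or> x mod 10 = 1 \<or> x mod 10 = 2 \<or> x mod 10 = 3 \<or> x mod 10 = 4
      \<or> x mod 10 = 5 \<or> x mod 10 = 6 \<or> x mod 10 = 7 \<or> x mod 10 = 8 \<or> x mod 10 = 9"
    by presburger
  then have "x mod 10 \<in> {0, 1, 2, 3, 4, 5, 6, 7, 8, 9}" by blast
  \<comment> \<open>The digit \<open>a\<close> itself becomes the first summand:
    \<open>x - a\<close> is nonnegative, since \<open>a\<close> is at most the last digit of
    \<open>x\<close> or else \<open>a < 10 \<le> x\<close>.\<close>
  from assms(2)[OF this] obtain a where a: "a \<in> R" "0 \<le> a" "a < 10"
    "a \<le> x mod 10 \<or> 10 \<le> x" "(x - a) mod 10 \<in> R'"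
    using assms(3) by (auto simp: mod_diff_left_eq)
  moreover have "x mod 10 \<le> x" using assms(1) by (simp add: zmod_le_nonneg_dividend)
  ultimately show ?thesis
    unfolding mem_sumset by (intro bexI[of _ a]) (auto simp: residues_def)
qed

lemma residues_sum_infinite:
  assumes "\<And>a b. a \<in> R \<Longrightarrow> b \<in> R' \<Longrightarrow> (a + b) mod 10 \<noteq> 9"
  shows "infinite ({0..} - (residues R + residues R'))"
proof -
  have "10 * int i + 9 \<notin> residues R + residues R'" for i
  proof
    assume "10 * int i + 9 \<in> residues R + residues R'"
    then obtain a b where "a mod 10 \<in> R" "b mod 10 \<in> R'" "a + b = 10 * int i + 9"
      by (auto simp: residues_def elim!: set_plus_elim)
    moreover have "(10 * int i + 9) mod 10 = 9" by presburger
    ultimately have "(a mod 10 + b mod 10) mod 10 = 9" by (simp add: mod_add_eq)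
    then show False using assms \<open>a mod 10 \<in> R\<close> \<open>b mod 10 \<in> R'\<close> by blast
  qed
  then have "range (\<lambda>i. 10 * int i + 9) \<subseteq> {0..} - (residues R + residues R')" by auto
  moreover have "infinite (range (\<lambda>i. 10 * int i + 9))" by (rule range_inj_infinite) (auto simp: inj_on_def)
  ultimately show ?thesis by (rule infinite_super)
qed

text \<open>Truncation with \<open>k0 = 2\<close>: the first sumset has no gaps, the second has gaps
  below 2 only, and the mixed sumset contains 0 and 1 but misses the whole class of 9, an infinite
  supply of gaps.\<close>

lemma fringe_pair_residues:
  assumes R: "0 \<in> R" "1 \<in> R" "0 \<in> R'" "\<And>a b. a \<in> R \<Longrightarrow> b \<in> R' \<Longrightarrow> (a + b) mod 10 \<noteq> 9"
    and basis: "\<And>x. x \<ge> 0 \<Longrightarrow> x \<in> residues R + residues R"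
    and "\<And>x. x \<ge> 2 \<Longrightarrow> x \<in> residues R' + residues R'"
    and "card ({0..<2} - (residues R' + residues R')) = s"
  shows "\<exists>A B. fringe_pair s e A B"
proof (rule fringe_pair_truncate)
  show "infinite ({0..} - (residues R + residues R'))" using R by (intro residues_sum_infinite)
  have "x \<in> residues R + residues R'" if "x = 0 \<or> x = 1" for x
    unfolding mem_sumset using R that by (intro bexI[of _ x]) (auto simp: residues_def)
  moreover have "{0..<2::int} = {0, 1}" by auto
  ultimately show "{0..<2} \<subseteq> residues R + residues R'" by simp
  have "{0..<2} - (residues R + residues R) = {}" using basis by auto
  then show "card ({0..<2} - (residues R + residues R)) + card ({0..<2} - (residues R' + residues R')) = s"
    using assms by simp
qed (use assms in \<open>auto simp: residues_def\<close>)

text \<open>After a shift it remains to have no gap in \<open>A + B\<close>, or at most one missing sum. In the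
  latter case, modulo 10, \<open>A\<close> and \<open>B\<close> are bases of order 2 (up to the sum 1) while \<open>A + B\<close> omits
  the class of 9; the residues were found by computer search.\<close>
lemma fringe_pair_exists: "\<exists>A B. fringe_pair s e A B"
proof (cases "e \<le> s div 2")
  case True
  \<comment> \<open>A shift by \<open>e\<close> will provide all \<open>e\<close> mixed gaps and
    \<open>2 * e\<close> missing sums. The starting pair therefore has no mixed gap and
    \<open>s - 2 * e\<close> missing sums, all of them in \<open>?B + ?B\<close>.\<close>
  let ?t = "int (s - 2 * e)"
  let ?B = "{0} \<union> {?t + 1..}"
  have "{0..} - (?B + ?B) = {1..?t}"
  proof (rule set_eqI)
    fix x show "x \<in> {0..} - (?B + ?B) \<longleftrightarrow> x \<in> {1..?t}"
    proof (cases "x \<in> ?B")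
      case True
      then have "x \<in> ?B + ?B" by (auto simp: mem_sumset intro: bexI[of _ 0])
      then show ?thesis using True by auto
    next
      case False
      then show ?thesis by (auto simp: mem_sumset)
    qed
  qed
  moreover have "{0..} + ?B = {0..}" "{0..} + {0..} = {0::int..}"
    by (auto simp: mem_sumset intro!: bexI[of _ "_::int"] elim!: set_plus_elim)
  ultimately have "fringe_pair (s - 2 * e) 0 {0..} ?B"
    unfolding fringe_pair_def by (auto intro!: exI[of _ "?t + 1"])
  from fringe_pair_shift[OF this, of e] show ?thesis using True by auto
next
  case False
  \<comment> \<open>A shift by \<open>s div 2\<close> will account for the even part of
    \<open>s\<close> and for \<open>s div 2\<close> mixed gaps.\<close>
  define e' where "e' = e - s div 2"
  have "\<exists>A B. fringe_pair (s mod 2) e' A B"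
  proof (cases "s mod 2 = 0")
    case True
    show ?thesis
    proof (rule fringe_pair_residues[where R = "{0,1,3,4,5}" and R' = "{0,1,2,3,7}"])
      show "x \<in> residues {0,1,3,4,5} + residues {0,1,3,4,5}" if "x \<ge> 0" for x
        using that by (intro mem_sum_residues[where c = 10]; (elim insertE emptyE)?; simp)
      show "x \<in> residues {0,1,2,3,7} + residues {0,1,2,3,7}" if "x \<ge> 2" for x
        using that by (intro mem_sum_residues[where c = 10]; (elim insertE emptyE)?; simp)
      have "x \<in> residues {0,1,2,3,7} + residues {0,1,2,3,7}" if "x \<ge> 0" for x
        using that by (intro mem_sum_residues[where c = 10]; (elim insertE emptyE)?; simp)
      then show "card ({0..<2} - (residues {0,1,2,3,7} + residues {0,1,2,3,7})) = s mod 2"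
        using True by (subst Diff_eq_empty_iff[THEN iffD2]) auto
    qed auto
  next
    case False
    show ?thesis
    proof (rule fringe_pair_residues[where R = "{0,1,3,4,8}" and R' = "{0,2,3,4,7}"])
      show "x \<in> residues {0,1,3,4,8} + residues {0,1,3,4,8}" if "x \<ge> 0" for x
        using that by (intro mem_sum_residues[where c = 10]; (elim insertE emptyE)?; simp)
      show "x \<in> residues {0,2,3,4,7} + residues {0,2,3,4,7}" if "x \<ge> 2" for x
      proof -
        \<comment> \<open>Modulo 10 the digit 1 arises only as 4 + 7, with a carry. Thus 11, 21, ...
          are sums and 1 is the single missing one.\<close>
        have "x \<ge> 10" if "x mod 10 = 1" using that \<open>x \<ge> 2\<close> by presburger
        then show ?thesis
          using that by (intro mem_sum_residues[where c = 1]; (elim insertE emptyE)?; simp)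
      qed
      have "0 \<in> residues {0,2,3,4,7} + residues {0,2,3,4,7}"
        unfolding mem_sumset by (intro bexI[of _ 0]) (auto simp: residues_def)
      moreover have "1 \<notin> residues {0,2,3,4,7} + residues {0,2,3,4,7}"
      proof
        assume "1 \<in> residues {0,2,3,4,7} + residues {0,2,3,4,7}"
        then obtain a where "a \<in> residues {0,2,3,4,7}" "1 - a \<in> residues {0,2,3,4,7}"
          by (auto simp: mem_sumset)
        moreover from this have "a = 0 \<or> a = 1" by (auto simp: residues_def)
        ultimately show False by (auto simp: residues_def)
      qed
      moreover have "{0..<2::int} = {0, 1}" by auto
      ultimately have "{0..<2} - (residues {0,2,3,4,7} + residues {0,2,3,4,7}) = {1}" by auto
      then show "card ({0..<2} - (residues {0,2,3,4,7} + residues {0,2,3,4,7})) = s mod 2"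
        using False by simp
    qed auto
  qed
  then obtain A B where "fringe_pair (s mod 2) e' A B" by blast
  from fringe_pair_shift[OF this, of "s div 2"] False show ?thesis
    by (auto simp: e'_def mult.commute)
qed

subsection \<open>The central limit theorem for random subsets\<close>

lemma cos_power_tendsto: "(\<lambda>N. cos (t / sqrt (real N)) ^ N) \<longlonglongrightarrow> exp (- (t^2) / 2)"
proof -
  have "(\<lambda>N. cos (t / sqrt (real N)) ^ N) \<longlonglongrightarrow> exp (- (t * t / 2))" by real_asymp
  then show ?thesis by (simp add: power2_eq_square)
qed

abbreviation prob_Pow :: "'a set \<Rightarrow> ('a set \<Rightarrow> bool) \<Rightarrow> real" where
  "prob_Pow U P \<equiv> measure_pmf.prob (pmf_of_set (Pow U)) {S. P S}"

text \<open>The standardised cardinality: \<open>card S\<close> has mean \<open>card U / 2\<close>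
  and variance \<open>card U / 4\<close>.\<close>

definition centred_card :: "'a set \<Rightarrow> 'a set \<Rightarrow> real" where
  "centred_card U S = (2 * real (card S) - real (card U)) / sqrt (real (card U))"

text \<open>The centred cardinality is a sum of independent signs, +1 for elements of
  \<open>S\<close> and -1 for the others. Summing the resulting products over all subsets expands
  the power of a binomial, which is \<open>2 * cos\<close>.\<close>

lemma char_centred_card:
  assumes "finite U"
  shows "char (distr (measure_pmf (pmf_of_set (Pow U))) borel (centred_card U)) t
           = of_real (cos (t / sqrt (real (card U))) ^ card U)"
proof -
  let ?N = "card U" and ?v = "t / sqrt (real (card U))"
  have pmf: "pmf (pmf_of_set (Pow U)) S = 1 / 2 ^ ?N" if "S \<in> Pow U" for S
    using assms that by (subst pmf_of_set) (auto simp: card_Pow)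
  have supp: "set_pmf (pmf_of_set (Pow U)) = Pow U"
    using assms by (intro set_pmf_of_set) auto
  have "char (distr (measure_pmf (pmf_of_set (Pow U))) borel (centred_card U)) t
     = (LINT S|measure_pmf (pmf_of_set (Pow U)). iexp (t * centred_card U S))"
    unfolding char_def by (subst integral_distr) auto
  also have "\<dots> = (\<Sum>S\<in>Pow U. iexp (t * centred_card U S) / 2 ^ ?N)"
    using assms by (subst integral_measure_pmf[of "Pow U"]) (auto simp: supp pmf scaleR_conv_of_real field_simps intro!: sum.cong)
  also have "\<dots> = (\<Sum>S\<in>Pow U. (\<Prod>x\<in>S. iexp ?v) * (\<Prod>x\<in>U - S. iexp (- ?v))) / 2 ^ ?N"
    unfolding sum_divide_distrib
  proof (rule sum.cong)
    fix S assume S: "S \<in> Pow U"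
    then have "real (card (U - S)) = real ?N - real (card S)"
      using assms by (metis PowD card_Diff_subset card_mono finite_subset of_nat_diff)
    then have "2 * real (card S) - real ?N = real (card S) - real (card (U - S))" by simp
    moreover have "t * centred_card U S = (2 * real (card S) - real ?N) * ?v"
      by (simp add: centred_card_def)
    ultimately have "t * centred_card U S = (real (card S) - real (card (U - S))) * ?v" by (simp only:)
    then have e: "t * centred_card U S = real (card S) * ?v + real (card (U - S)) * (- ?v)"
      by (simp only: left_diff_distrib mult_minus_right add_uminus_conv_diff)
    show "iexp (t * centred_card U S) / 2 ^ ?N
        = (\<Prod>x\<in>S. iexp ?v) * (\<Prod>x\<in>U - S. iexp (- ?v)) / 2 ^ ?N"
      unfolding e prod_constant by (simp add: exp_of_nat_mult[symmetric] exp_add[symmetric] algebra_simps)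
  qed simp
  also have "\<dots> = (iexp ?v + iexp (- ?v)) ^ ?N / 2 ^ ?N"
    using assms by (subst prod_add[symmetric]) auto
  also have "iexp ?v + iexp (- ?v) = 2 * of_real (cos ?v)"
    by (simp add: cos_of_real[symmetric] cos_exp_eq)
  finally show ?thesis by (simp add: power_mult_distrib)
qed

lemma isCont_cdf_std_normal: "isCont (cdf std_normal_distribution) x"
proof -
  interpret real_distribution std_normal_distribution by (rule real_dist_normal_dist)
  show ?thesis
    unfolding isCont_cdf by (simp add: measure_def emeasure_density nn_integral_null_set)
qed

text \<open>Levy's continuity theorem applies, and the limit distribution function has no
  jumps.\<close>

lemma prob_centred_card_tendsto:
  fixes U :: "nat \<Rightarrow> 'a set"
  assumes fin: "\<And>n. finite (U n)" and lim: "filterlim (\<lambda>n. card (U n)) at_top sequentially"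
  shows "(\<lambda>n. prob_Pow (U n) (\<lambda>S. centred_card (U n) S \<le> x)) \<longlonglongrightarrow> cdf std_normal_distribution x"
proof -
  let ?M = "\<lambda>n. distr (measure_pmf (pmf_of_set (Pow (U n)))) borel (centred_card (U n))"
  have "weak_conv_m ?M std_normal_distribution"
  proof (rule levy_continuity)
    show "real_distribution (?M n)" for n
      unfolding real_distribution_def real_distribution_axioms_def
      by (auto intro!: measure_pmf.prob_space_distr)
    show "(\<lambda>n. char (?M n) t) \<longlonglongrightarrow> char std_normal_distribution t" for t
      unfolding char_centred_card[OF fin] char_std_normal_distribution
      by (intro tendsto_of_real filterlim_compose[OF cos_power_tendsto lim])
  qed (rule real_dist_normal_dist)
  moreover have "isCont (cdf std_normal_distribution) x" by (rule isCont_cdf_std_normal)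
  ultimately have "(\<lambda>n. cdf (?M n) x) \<longlonglongrightarrow> cdf std_normal_distribution x"
    by (auto simp: weak_conv_m_def weak_conv_def)
  moreover have "cdf (?M n) x = prob_Pow (U n) (\<lambda>S. centred_card (U n) S \<le> x)" for n
    unfolding cdf_def by (subst measure_distr) (auto intro!: arg_cong[where f = "measure_pmf.prob _"])
  ultimately show ?thesis by simp
qed

text \<open>The moving threshold is needed because standardising over the middle part instead of
  \<open>[0,n]\<close> perturbs \<open>t\<close>. Eventually \<open>y n\<close> is within
  \<open>d / 2\<close> of \<open>t\<close>, which squeezes the probability between those for the
  fixed thresholds \<open>t - d / 2\<close> and \<open>t + d / 2\<close>; continuity of the limit
  does the rest.\<close>

lemma prob_centred_card_less_tendsto:
  fixes U :: "nat \<Rightarrow> 'a set"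
  assumes fin: "\<And>n. finite (U n)" and lim: "filterlim (\<lambda>n. card (U n)) at_top sequentially"
    and y: "y \<longlonglongrightarrow> t"
  shows "(\<lambda>n. prob_Pow (U n) (\<lambda>S. centred_card (U n) S < y n)) \<longlonglongrightarrow> cdf std_normal_distribution t"
proof (rule LIMSEQ_I)
  let ?F = "cdf std_normal_distribution"
  have cont: "isCont ?F t" by (rule isCont_cdf_std_normal)
  fix r :: real assume "0 < r"
  then obtain d where d: "d > 0" "\<And>x. \<bar>x - t\<bar> < d \<Longrightarrow> \<bar>?F x - ?F t\<bar> < r / 2"
    using cont[unfolded continuous_at_eps_delta, rule_format, of "r / 2"] by (auto simp: dist_real_def)
  have F: "\<bar>?F (t - d / 2) - ?F t\<bar> < r / 2" "\<bar>?F (t + d / 2) - ?F t\<bar> < r / 2"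
    using d by (auto simp: abs_if)
  have "\<forall>\<^sub>F n in sequentially. \<bar>y n - t\<bar> < d / 2"
    using y[unfolded tendsto_iff, rule_format, of "d / 2"] d(1) by (simp add: dist_real_def)
  moreover have "\<forall>\<^sub>F n in sequentially. \<bar>prob_Pow (U n) (\<lambda>S. centred_card (U n) S \<le> x) - ?F x\<bar> < r / 2" for x
    using prob_centred_card_tendsto[OF fin lim, of x, unfolded tendsto_iff, rule_format, of "r / 2"] \<open>0 < r\<close> by (simp add: dist_real_def)
  ultimately have "\<forall>\<^sub>F n in sequentially. \<bar>y n - t\<bar> < d / 2
      \<and> \<bar>prob_Pow (U n) (\<lambda>S. centred_card (U n) S \<le> t - d / 2) - ?F (t - d / 2)\<bar> < r / 2
      \<and> \<bar>prob_Pow (U n) (\<lambda>S. centred_card (U n) S \<le> t + d / 2) - ?F (t + d / 2)\<bar> < r / 2"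
    by (intro eventually_conj)
  then have "\<forall>\<^sub>F n in sequentially.
      norm (prob_Pow (U n) (\<lambda>S. centred_card (U n) S < y n) - ?F t) < r"
  proof eventually_elim
    case (elim n)
    have "prob_Pow (U n) (\<lambda>S. centred_card (U n) S \<le> t - d / 2)
        \<le> prob_Pow (U n) (\<lambda>S. centred_card (U n) S < y n)"
      using elim(1) by (intro measure_pmf.finite_measure_mono) (auto simp: abs_if field_simps split: if_splits)
    moreover have "prob_Pow (U n) (\<lambda>S. centred_card (U n) S < y n)
        \<le> prob_Pow (U n) (\<lambda>S. centred_card (U n) S \<le> t + d / 2)"
      using elim(1) by (intro measure_pmf.finite_measure_mono) (auto simp: abs_if field_simps split: if_splits)
    ultimately show ?case using elim F by (auto simp: abs_if split: if_splits)
  qed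
  then show "\<exists>no. \<forall>n\<ge>no. norm (prob_Pow (U n) (\<lambda>S. centred_card (U n) S < y n) - ?F t) < r"
    by (simp add: eventually_sequentially)
qed

text \<open>The middle part has \<open>n - 2 * K + 1\<close> elements. Neither this bounded change
  of size nor the offset \<open>c\<close> matters on the scale of \<open>sqrt n\<close>. The offset
  will be 0 or \<open>2 * K\<close>, the extreme bounds for the number of fringe elements.\<close>

lemma middle_card_tendsto:
  fixes K :: nat and c t :: real
  shows "(\<lambda>n. prob_Pow {int K..int n - int K} (\<lambda>T. real (card T) + c < (real n + t * sqrt (real n)) / 2))
    \<longlonglongrightarrow> cdf std_normal_distribution t"
proof -
  let ?U = "\<lambda>n. {int K..int n - int K}"
  let ?y = "\<lambda>n. (real n + t * sqrt (real n) - 2 * c - (real n - 2 * real K + 1)) / sqrt (real n - 2 * real K + 1)"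
  have "?y \<longlonglongrightarrow> t" by real_asymp
  moreover have "filterlim (\<lambda>n. card (?U n)) at_top sequentially"
  proof (rule filterlim_at_top_mono)
    show "filterlim (\<lambda>n. n - 2 * K) at_top sequentially" by (rule filterlim_minus_const_nat_at_top)
    show "\<forall>\<^sub>F n in sequentially. n - 2 * K \<le> card (?U n)" by (rule always_eventually) auto
  qed
  ultimately have lim: "(\<lambda>n. prob_Pow (?U n) (\<lambda>T. centred_card (?U n) T < ?y n)) \<longlonglongrightarrow> cdf std_normal_distribution t"
    by (intro prob_centred_card_less_tendsto) auto
  have "\<forall>\<^sub>F n in sequentially. prob_Pow (?U n) (\<lambda>T. centred_card (?U n) T < ?y n) =
      prob_Pow (?U n) (\<lambda>T. real (card T) + c < (real n + t * sqrt (real n)) / 2)"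
    using eventually_ge_at_top[of "2 * K"]
  proof eventually_elim
    case (elim n)
    then have N: "real (card (?U n)) = real n - 2 * real K + 1" by (simp add: of_nat_diff nat_diff_distrib)
    have "centred_card (?U n) T < ?y n \<longleftrightarrow> real (card T) + c < (real n + t * sqrt (real n)) / 2" for T
      using elim unfolding centred_card_def N by (subst divide_less_cancel) auto
    then show ?case by simp
  qed
  from Lim_transform_eventually[OF lim this] show ?thesis .
qed

subsection \<open>Random subsets\<close>

lemma prob_Pow_eq:
  assumes "finite U"
  shows "prob_Pow U P = real (card {S \<in> Pow U. P S}) / 2 ^ card U"
proof -
  have "Pow U \<inter> {S. P S} = {S \<in> Pow U. P S}" by auto
  then show ?thesis
    using assms by (subst measure_pmf_of_set) (auto simp: card_Pow)
qed

lemma prob_Pow_mono: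
  assumes "finite U" "\<And>S. S \<subseteq> U \<Longrightarrow> P S \<Longrightarrow> Q S"
  shows "prob_Pow U P \<le> prob_Pow U Q"
  unfolding prob_Pow_eq[OF assms(1)] using assms
  by (intro divide_right_mono of_nat_mono card_mono) auto

lemma prob_Pow_cong:
  assumes "finite U" "\<And>S. S \<subseteq> U \<Longrightarrow> P S \<longleftrightarrow> Q S"
  shows "prob_Pow U P = prob_Pow U Q"
  by (intro antisym prob_Pow_mono) (use assms in auto)

text \<open>Independence of the traces on disjoint sets, by counting: a subset of the union
  corresponds to the pair of its traces.\<close>

lemma prob_Pow_Un:
  assumes "finite V" "finite W" "V \<inter> W = {}"
  shows "prob_Pow (V \<union> W) (\<lambda>S. P (S \<inter> V) \<and> Q (S \<inter> W)) = prob_Pow V P * prob_Pow W Q"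
proof -
  have "bij_betw (\<lambda>S. (S \<inter> V, S \<inter> W)) {S \<in> Pow (V \<union> W). P (S \<inter> V) \<and> Q (S \<inter> W)}
      ({S \<in> Pow V. P S} \<times> {S \<in> Pow W. Q S})"
  proof (rule bij_betw_byWitness[where f' = "\<lambda>(X, Y). X \<union> Y"])
    have *: "(X \<union> Y) \<inter> V = X" "(X \<union> Y) \<inter> W = Y" if "X \<subseteq> V" "Y \<subseteq> W" for X Y
      using assms that by auto
    show "\<forall>z\<in>{S \<in> Pow V. P S} \<times> {S \<in> Pow W. Q S}.
        ((case z of (X, Y) \<Rightarrow> X \<union> Y) \<inter> V, (case z of (X, Y) \<Rightarrow> X \<union> Y) \<inter> W) = z"
      by (auto simp: *)
    show "(\<lambda>(X, Y). X \<union> Y) ` ({S \<in> Pow V. P S} \<times> {S \<in> Pow W. Q S})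
        \<subseteq> {S \<in> Pow (V \<union> W). P (S \<inter> V) \<and> Q (S \<inter> W)}"
      by (auto simp: *)
  qed auto
  from bij_betw_same_card[OF this] show ?thesis
    using assms by (simp add: prob_Pow_eq card_cartesian_product card_Un_disjoint power_add)
qed

lemma prob_Pow_Int:
  assumes "finite U" "W \<subseteq> U"
  shows "prob_Pow U (\<lambda>S. Q (S \<inter> W)) = prob_Pow W Q"
proof -
  have fin: "finite (U - W)" "finite W" using assms finite_subset by auto
  show ?thesis
    using prob_Pow_Un[OF fin, of "\<lambda>_. True" Q] assms(2) by (simp add: Un_absorb2 Diff_Int_distrib2)
qed

text \<open>Disjoint pairs behave independently, and three of the four traces on a pair avoid
  containing it. The induction splits off one pair at a time.\<close>

lemma prob_Pow_avoid_pairs: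
  assumes "finite I" "finite U" "f ` I \<subseteq> U" "g ` I \<subseteq> U" "inj_on f I" "inj_on g I" "f ` I \<inter> g ` I = {}"
  shows "prob_Pow U (\<lambda>S. \<forall>i\<in>I. \<not> (f i \<in> S \<and> g i \<in> S)) \<le> (3 / 4) ^ card I"
  using assms
proof (induction I arbitrary: U rule: finite_induct)
  case (insert i I)
  let ?V = "{f i, g i}" let ?W = "U - ?V"
  let ?Q = "\<lambda>S. \<forall>i\<in>I. \<not> (f i \<in> S \<and> g i \<in> S)"
  have fg: "f i \<noteq> g i" using insert.prems by auto
  have W: "f j \<in> ?W" "g j \<in> ?W" if "j \<in> I" for j
  proof -
    have ij: "i \<noteq> j" "j \<in> insert i I" using insert.hyps(2) that by auto
    have "f j \<noteq> f i" "g j \<noteq> g i"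
      using inj_onD[OF insert.prems(4), of j i] inj_onD[OF insert.prems(5), of j i] ij by auto
    moreover have "f j \<noteq> g i" "g j \<noteq> f i" "f j \<in> U" "g j \<in> U"
      using insert.prems(2,3,6) ij(2) by blast+
    ultimately show "f j \<in> ?W" "g j \<in> ?W" by auto
  qed
  have U: "?V \<union> ?W = U" using insert.prems by auto
  have "{S \<in> Pow ?V. \<not> (f i \<in> S \<and> g i \<in> S)} = Pow ?V - {?V}" by auto
  moreover have "card (Pow ?V - {?V}) = 3" using fg by (subst card_Diff_subset) (auto simp: card_Pow)
  ultimately have V: "prob_Pow ?V (\<lambda>S. \<not> (f i \<in> S \<and> g i \<in> S)) = 3 / 4"
    using fg by (simp add: prob_Pow_eq)
  have "prob_Pow U (\<lambda>S. \<forall>i\<in>insert i I. \<not> (f i \<in> S \<and> g i \<in> S))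
      = prob_Pow (?V \<union> ?W) (\<lambda>S. \<not> (f i \<in> S \<inter> ?V \<and> g i \<in> S \<inter> ?V) \<and> ?Q (S \<inter> ?W))"
    unfolding U using insert.prems W by (intro prob_Pow_cong) auto
  also have "\<dots> = prob_Pow ?V (\<lambda>S. \<not> (f i \<in> S \<and> g i \<in> S)) * prob_Pow ?W ?Q"
    using insert.prems(1) by (intro prob_Pow_Un) auto
  also have "\<dots> = 3 / 4 * prob_Pow ?W ?Q" unfolding V ..
  also have "\<dots> \<le> 3 / 4 * (3 / 4) ^ card I"
    using insert.prems W by (intro mult_left_mono insert.IH) auto
  finally show ?case using insert.hyps by simp
qed simp

lemma prob_Pow_Bex_le:
  assumes "finite X"
  shows "prob_Pow U (\<lambda>S. \<exists>x\<in>X. P x S) \<le> (\<Sum>x\<in>X. prob_Pow U (P x))"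
proof -
  have "{S. \<exists>x\<in>X. P x S} = (\<Union>x\<in>X. {S. P x S})" by auto
  then show ?thesis using assms measure_pmf.finite_measure_subadditive_finite by auto
qed

lemma prob_Pow_disj_le:
  "prob_Pow U (\<lambda>S. P S \<or> Q S) \<le> prob_Pow U P + prob_Pow U Q"
  unfolding Collect_disj_eq by (rule measure_subadditive) auto

subsection \<open>Missing sums and differences of random subsets\<close>

lemma sum_geometric_tail_le:
  fixes \<rho> :: real
  assumes "0 \<le> \<rho>" "\<rho> < 1" "finite X" "inj_on h X" "\<And>x. x \<in> X \<Longrightarrow> K \<le> h x"
  shows "(\<Sum>x\<in>X. \<rho> ^ h x) \<le> \<rho> ^ K / (1 - \<rho>)"
proof -
  have inj: "inj_on (\<lambda>x. h x - K) X"
    using assms(4,5) by (auto simp: inj_on_def) (metis le_add_diff_inverse)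
  have "(\<Sum>x\<in>X. \<rho> ^ h x) = \<rho> ^ K * (\<Sum>x\<in>X. \<rho> ^ (h x - K))"
    unfolding sum_distrib_left using assms(5) by (intro sum.cong) (auto simp flip: power_add)
  also have "(\<Sum>x\<in>X. \<rho> ^ (h x - K)) = (\<Sum>k\<in>(\<lambda>x. h x - K) ` X. \<rho> ^ k)"
    by (simp add: sum.reindex[OF inj])
  also have "\<dots> \<le> (\<Sum>k. \<rho> ^ k)"
    using assms by (intro sum_le_suminf) (auto intro: summable_geometric)
  also have "\<dots> = 1 / (1 - \<rho>)" using assms by (intro suminf_geometric) auto
  finally show ?thesis using assms by (simp add: mult_left_mono)
qed

text \<open>The number of disjoint pairs available is at least half the distance to an end of the
  range; the square root absorbs this half, so that exponents are plain distances.\<close>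

abbreviation (input) \<rho> :: real where "\<rho> \<equiv> sqrt (3 / 4)"

lemma rho: "0 \<le> \<rho>" "\<rho> < 1" "\<rho>\<^sup>2 = 3 / 4"
  by (auto simp: real_sqrt_lt_1_iff)

lemma power_three_quarters_le:
  assumes "y \<le> 2 * N" shows "(3 / 4) ^ N \<le> \<rho> ^ y"
proof -
  have "(3 / 4) ^ N = \<rho> ^ (2 * N)" unfolding power_mult rho ..
  also have "\<dots> \<le> \<rho> ^ y" using assms rho by (intro power_decreasing) auto
  finally show ?thesis .
qed

text \<open>A missing sum \<open>x\<close> avoids all the disjoint pairs \<open>{a, x - a}\<close>.
  Bounding by a sum of two powers instead of one with the minimal exponent lets each end be summed
  as a geometric series.\<close>

lemma prob_not_sum:
  "prob_Pow {p..q} (\<lambda>S. x \<notin> S + S) \<le> \<rho> ^ nat (x - 2 * p) + \<rho> ^ nat (2 * q - x)" for p q x :: int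
proof -
  \<comment> \<open>The lower limit keeps \<open>a\<close> and \<open>x - a\<close> in
    \<open>[p,q]\<close>; the upper one says \<open>a < x - a\<close>, which excludes the degenerate
    pair at \<open>x / 2\<close>.\<close>
  let ?I = "{max p (x - q)..<(x + 1) div 2}"
  have "prob_Pow {p..q} (\<lambda>S. x \<notin> S + S) \<le> prob_Pow {p..q} (\<lambda>S. \<forall>a\<in>?I. \<not> (a \<in> S \<and> x - a \<in> S))"
    by (intro prob_Pow_mono) (auto simp: mem_sumset)
  also have "\<dots> \<le> (3 / 4) ^ card ?I"
    by (intro prob_Pow_avoid_pairs) (auto simp: inj_on_def)
  also have "\<dots> \<le> \<rho> ^ min (nat (x - 2 * p)) (nat (2 * q - x))"
    by (intro power_three_quarters_le) (simp; linarith)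
  also have "\<dots> \<le> \<rho> ^ nat (x - 2 * p) + \<rho> ^ nat (2 * q - x)"
    using rho by (simp add: min_def)
  finally show ?thesis .
qed

lemma prob_not_difference:
  fixes p q x :: int
  assumes "0 < x"
  shows "prob_Pow {p..q} (\<lambda>S. x \<notin> difference_set S) \<le> \<rho> ^ nat (q - p - x)"
proof -
  \<comment> \<open>The pairs \<open>{a, a + x}\<close> with \<open>a\<close> in an even block of length \<open>x\<close> are disjoint.\<close>
  let ?J = "{p..q - x}" and ?E = "\<lambda>a. even ((a - p) div x)"
  let ?I = "{a \<in> ?J. ?E a}"
  have fin: "finite {a \<in> ?J. R a}" for R by (rule finite_subset[of _ ?J]) auto
  have E: "?E (a + x) \<longleftrightarrow> \<not> ?E a" for a
  proof -
    have "(a + x - p) div x = (a - p) div x + 1"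
      using assms div_add_self2[of x "a - p"] by (simp add: algebra_simps)
    then show ?thesis by simp
  qed
  have "prob_Pow {p..q} (\<lambda>S. x \<notin> difference_set S)
      \<le> prob_Pow {p..q} (\<lambda>S. \<forall>a\<in>?I. \<not> (a \<in> S \<and> a + x \<in> S))"
    by (intro prob_Pow_mono) (auto simp: mem_difference_set)
  also have "\<dots> \<le> (3 / 4) ^ card ?I"
  proof (rule prob_Pow_avoid_pairs)
    have "a + x \<notin> ?I" if "a \<in> ?I" for a using E[of a] that by blast
    then show "(\<lambda>a. a) ` ?I \<inter> (\<lambda>a. a + x) ` ?I = {}" by auto
  qed (use assms fin[of ?E] in \<open>auto simp: inj_on_def\<close>)
  also have "\<dots> \<le> \<rho> ^ nat (q - p - x)"
  proof (rule power_three_quarters_le)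
    \<comment> \<open>Subtracting \<open>x\<close> maps the odd blocks injectively into the even
      ones. It does not leave \<open>?J\<close>, since the first block is even. So at least half of
      all starting points are kept.\<close>
    have "card {a \<in> ?J. \<not> ?E a} \<le> card ?I"
    proof (rule card_inj_on_le)
      show "(\<lambda>a. a - x) ` {a \<in> ?J. \<not> ?E a} \<subseteq> ?I"
      proof clarify
        fix a assume a: "a \<in> ?J" "\<not> ?E a"
        have "a - x \<ge> p"
        proof (rule ccontr)
          assume "\<not> a - x \<ge> p"
          then have "(a - p) div x = 0" using a by (intro div_pos_pos_trivial) auto
          then show False using a by simp
        qed
        then show "a - x \<in> ?J \<and> ?E (a - x)" using a E[of "a - x"] assms by auto
      qed
    qed (use fin[of ?E] in \<open>auto simp: inj_on_def\<close>)
    moreover have "card ?J = card ?I + card {a \<in> ?J. \<not> ?E a}"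
    proof -
      have "?J = ?I \<union> {a \<in> ?J. \<not> ?E a}" by blast
      moreover have "card (?I \<union> {a \<in> ?J. \<not> ?E a}) = card ?I + card {a \<in> ?J. \<not> ?E a}"
        by (intro card_Un_disjoint fin) blast
      ultimately show ?thesis by (simp only:)
    qed
    moreover have "nat (q - p - x) \<le> card ?J" by simp
    ultimately show "nat (q - p - x) \<le> 2 * card ?I" by linarith
  qed
  finally show ?thesis .
qed

text \<open>Union bound: the sums contribute one geometric tail at each end of their range, the
  differences a third. The bound does not depend on the interval.\<close>

lemma prob_not_full:
  "prob_Pow {p..q} (\<lambda>S. \<not> full p q (int K) S) \<le> 3 * (\<rho> ^ K / (1 - \<rho>))"
proof -
  let ?X = "{2 * p + int K..2 * q - int K}" and ?Y = "{1..q - p - int K}"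
  have "prob_Pow {p..q} (\<lambda>S. \<not> full p q (int K) S)
      \<le> prob_Pow {p..q} (\<lambda>S. (\<exists>x\<in>?X. x \<notin> S + S) \<or> (\<exists>x\<in>?Y. x \<notin> difference_set S))"
  proof (rule prob_Pow_mono)
    fix S :: "int set"
    assume "\<not> full p q (int K) S"
    then consider "\<exists>x\<in>?X. x \<notin> S + S" | x where "?X \<subseteq> S + S" "x \<in> {0..q - p - int K}" "x \<notin> difference_set S"
      unfolding full_def by blast
    then show "(\<exists>x\<in>?X. x \<notin> S + S) \<or> (\<exists>x\<in>?Y. x \<notin> difference_set S)"
    proof cases
      case (2 x)
      \<comment> \<open>The difference 0 occurs once \<open>S\<close> is nonempty. If 0 lies in the
        required range of differences, the required range of sums is nonempty, which forces an
        element of \<open>S\<close>.\<close>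
      have "x \<noteq> 0"
      proof
        assume "x = 0"
        then have "2 * p + int K \<in> ?X" using 2 by auto
        then have "2 * p + int K \<in> S + S" using 2 by blast
        then obtain a where "a \<in> S" by (auto simp: mem_sumset)
        then have "0 \<in> difference_set S" by (auto simp: mem_difference_set)
        then show False using 2 \<open>x = 0\<close> by simp
      qed
      then show ?thesis using 2 by auto
    qed auto
  qed simp
  also have "\<dots> \<le> (\<Sum>x\<in>?X. prob_Pow {p..q} (\<lambda>S. x \<notin> S + S)) + (\<Sum>x\<in>?Y. prob_Pow {p..q} (\<lambda>S. x \<notin> difference_set S))"
    by (intro order_trans[OF prob_Pow_disj_le] add_mono prob_Pow_Bex_le) auto
  also have "(\<Sum>x\<in>?X. prob_Pow {p..q} (\<lambda>S. x \<notin> S + S))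
      \<le> (\<Sum>x\<in>?X. \<rho> ^ nat (x - 2 * p)) + (\<Sum>x\<in>?X. \<rho> ^ nat (2 * q - x))"
    unfolding sum.distrib[symmetric] by (intro sum_mono prob_not_sum)
  also have "(\<Sum>x\<in>?X. \<rho> ^ nat (x - 2 * p)) \<le> \<rho> ^ K / (1 - \<rho>)"
    using rho by (intro sum_geometric_tail_le) (auto simp: inj_on_def)
  also have "(\<Sum>x\<in>?X. \<rho> ^ nat (2 * q - x)) \<le> \<rho> ^ K / (1 - \<rho>)"
    using rho by (intro sum_geometric_tail_le) (auto simp: inj_on_def)
  also have "(\<Sum>x\<in>?Y. prob_Pow {p..q} (\<lambda>S. x \<notin> difference_set S)) \<le> (\<Sum>x\<in>?Y. \<rho> ^ nat (q - p - x))"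
    by (intro sum_mono prob_not_difference) auto
  also have "(\<Sum>x\<in>?Y. \<rho> ^ nat (q - p - x)) \<le> \<rho> ^ K / (1 - \<rho>)"
    using rho by (intro sum_geometric_tail_le) (auto simp: inj_on_def)
  finally show ?thesis by simp
qed

lemma prob_not_full_small:
  assumes "0 < \<epsilon>"
  obtains K where "\<And>p q. prob_Pow {p..q} (\<lambda>S. \<not> full p q (int K) S) \<le> \<epsilon>"
proof -
  have "(\<lambda>K. 3 * (\<rho> ^ K / (1 - \<rho>))) \<longlonglongrightarrow> 3 * (0 / (1 - \<rho>))"
    using rho by (intro tendsto_intros LIMSEQ_power_zero) auto
  then have "\<forall>\<^sub>F K in sequentially. 3 * (\<rho> ^ K / (1 - \<rho>)) < \<epsilon>"
    using assms by (intro order_tendstoD) auto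
  then obtain K where "3 * (\<rho> ^ K / (1 - \<rho>)) < \<epsilon>" by (auto simp: eventually_sequentially)
  then show ?thesis using that[of K] prob_not_full[of _ _ K] by (meson less_imp_le order_trans)
qed

text \<open>Take a pair \<open>A\<close>, \<open>B\<close> with the right numbers of gaps and
  prescribe the fringe \<open>F\<close> made of \<open>A\<close> at the left and the mirror image of
  \<open>B\<close> at the right. This fringe has probability \<open>1 / 2 ^ (2 * K)\<close>, and
  independently the middle part completes it to a full set with probability at least 1/2.\<close>

lemma prob_missing_eq_ge:
  fixes s e :: nat
  shows "\<exists>c>0. \<forall>\<^sub>F n in sequentially. c \<le> prob_Pow {0..int n} (\<lambda>S. missing n S = (int s, 2 * int e))"
proof -
  obtain A B :: "int set" and m' where A: "A \<subseteq> {0..}" and B: "B \<subseteq> {0..}" and m': "{m'..} \<subseteq> A" "{m'..} \<subseteq> B"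
    and s: "card ({0..} - (A + A)) + card ({0..} - (B + B)) = s" and e: "card ({0..} - (A + B)) = e"
    using fringe_pair_exists[of s e] unfolding fringe_pair_def by blast
  define m where "m = nat m'"
  have m: "{int m..} \<subseteq> A" "{int m..} \<subseteq> B" using m' by (auto simp: m_def)
  obtain j where j: "\<And>p q. prob_Pow {p..q} (\<lambda>S. \<not> full p q (int j) S) \<le> 1 / 2"
    using prob_not_full_small[of "1 / 2"] by auto
  \<comment> \<open>Fullness of \<open>[m, n - m]\<close> with margin \<open>j\<close> covers the
    sums from \<open>2 * m + j\<close> on and the differences up to \<open>n - 2 * m - j\<close>.
    Moreover no sumset of \<open>A\<close> and \<open>B\<close> has a gap beyond
    \<open>2 * m\<close>.\<close>
  define K where "K = 2 * m + j"
  have gaps: "gaps K X Y = {0..} - (X + Y)" if "{int m..} \<subseteq> X" "{int m..} \<subseteq> Y" for X Y :: "int set"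
  proof -
    have "x \<in> X + Y" if "x \<ge> int K" for x
      unfolding mem_sumset using that \<open>{int m..} \<subseteq> X\<close> \<open>{int m..} \<subseteq> Y\<close>
      by (intro bexI[of _ "int m"]) (auto simp: K_def)
    then show ?thesis unfolding gaps_def by (auto simp: not_le[symmetric] simp del: not_le)
  qed
  let ?c = "1 / 2 ^ (2 * K) * (1 / 2) :: real"
  have "?c \<le> prob_Pow {0..int n} (\<lambda>S. missing n S = (int s, 2 * int e))" if n: "n \<ge> 2 * K" for n
  proof -
    let ?Fr = "{0..<int K} \<union> {int n - int K<..int n}" and ?Mid = "{int K..int n - int K}"
    let ?D = "{int m..int n - int m}"
    define F where "F = (A \<inter> {0..<int K}) \<union> (reflect n B \<inter> {int n - int K<..int n})"
    have F: "F \<subseteq> ?Fr" by (auto simp: F_def)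
    have Mid: "?Mid \<subseteq> ?D" by (auto simp: K_def)
    have D: "x \<in> F" if "x \<in> ?D" "x \<notin> ?Mid" for x
    proof (cases "x < int K")
      case True
      then show ?thesis using that m by (auto simp: F_def)
    next
      case False
      then have "int n - x \<in> {int m..}" "x \<in> {int n - int K<..int n}" using that n by auto
      then show ?thesis using m by (auto simp: F_def mem_reflect)
    qed
    \<comment> \<open>Being full is monotone, so forcing \<open>S\<close> to be all of \<open>?D - ?Mid\<close> does not lower its probability.\<close>
    have "1 / 2 \<le> prob_Pow ?D (\<lambda>S. full (int m) (int n - int m) (int j) S)"
      using j[of "int m" "int n - int m"]
        measure_pmf.prob_compl[of "{S. full (int m) (int n - int m) (int j) S}" "pmf_of_set (Pow ?D)"]
      by (simp add: Collect_neg_eq Compl_eq_Diff_UNIV)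
    also have "\<dots> \<le> prob_Pow ?D (\<lambda>S. full 0 (int n) (int K) (S \<inter> ?Mid \<union> F))"
    proof (rule prob_Pow_mono)
      fix S assume S: "S \<subseteq> ?D" "full (int m) (int n - int m) (int j) S"
      then have "full 0 (int n) (int K) S" by (auto simp: full_def K_def algebra_simps)
      moreover have "S \<subseteq> S \<inter> ?Mid \<union> F" using S(1) D by blast
      ultimately show "full 0 (int n) (int K) (S \<inter> ?Mid \<union> F)" by (rule full_mono)
    qed simp
    also have "\<dots> = prob_Pow ?Mid (\<lambda>T. full 0 (int n) (int K) (T \<union> F))"
      using Mid by (intro prob_Pow_Int) auto
    finally have mid: "1 / 2 \<le> prob_Pow ?Mid (\<lambda>T. full 0 (int n) (int K) (T \<union> F))" .
    have "{S \<in> Pow ?Fr. S = F} = {F}" using F by auto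
    moreover have "card ?Fr = 2 * K" using n by (subst card_Un_disjoint) auto
    ultimately have fr: "prob_Pow ?Fr (\<lambda>T. T = F) = 1 / 2 ^ (2 * K)"
      by (subst prob_Pow_eq) auto
    have U: "?Fr \<union> ?Mid = {0..int n}" "?Fr \<inter> ?Mid = {}" using n by auto
    have "?c \<le> prob_Pow ?Fr (\<lambda>T. T = F) * prob_Pow ?Mid (\<lambda>T. full 0 (int n) (int K) (T \<union> F))"
      unfolding fr using mid by (intro mult_left_mono) auto
    also have "\<dots> = prob_Pow (?Fr \<union> ?Mid) (\<lambda>S. S \<inter> ?Fr = F \<and> full 0 (int n) (int K) (S \<inter> ?Mid \<union> F))"
      using U(2) by (intro prob_Pow_Un[symmetric]) auto
    also have "\<dots> \<le> prob_Pow {0..int n} (\<lambda>S. missing n S = (int s, 2 * int e))"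
      unfolding U(1)
    proof (rule prob_Pow_mono)
      fix S assume S: "S \<subseteq> {0..int n}" and SF: "S \<inter> ?Fr = F \<and> full 0 (int n) (int K) (S \<inter> ?Mid \<union> F)"
      have "S = S \<inter> (?Fr \<union> ?Mid)" unfolding U(1) using S by blast
      then have "S \<inter> ?Mid \<union> F = S" using SF by blast
      then have full: "full 0 (int n) (int K) S" using SF by simp
      have in_fr: "x \<in> S \<longleftrightarrow> x \<in> F" if "x \<in> ?Fr" for x using SF that by blast
      have SA: "S \<inter> {0..<int K} = A \<inter> {0..<int K}"
      proof -
        have "x \<in> F \<longleftrightarrow> x \<in> A" if "x \<in> {0..<int K}" for x using that n by (auto simp: F_def)
        then show ?thesis using in_fr by blast
      qed
      have RB: "reflect n S \<inter> {0..<int K} = B \<inter> {0..<int K}"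
      proof -
        have "int n - x \<in> S \<longleftrightarrow> x \<in> B" if "x \<in> {0..<int K}" for x
          using that n in_fr[of "int n - x"] by (auto simp: F_def mem_reflect)
        then show ?thesis by (auto simp: mem_reflect)
      qed
      have pos: "S \<subseteq> {0..}" "reflect n S \<subseteq> {0..}" using S by (auto simp: reflect_def)
      have "missing n S = fringe_missing n (int K) S"
        using S full n by (intro missing_eq_fringe_missing) auto
      also have "\<dots> = (int s, 2 * int e)"
        unfolding fringe_missing_def gaps_cong[OF pos(1) A pos(1) A SA SA]
          gaps_cong[OF pos(2) B pos(2) B RB RB] gaps_cong[OF pos(1) A pos(2) B SA RB]
        using s e m by (simp add: gaps)
      finally show "missing n S = (int s, 2 * int e)" .
    qed simp
    finally show ?thesis .
  qed
  then have "\<forall>\<^sub>F n in sequentially. ?c \<le> prob_Pow {0..int n} (\<lambda>S. missing n S = (int s, 2 * int e))"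
    unfolding eventually_sequentially by blast
  moreover have "?c > 0" by simp
  ultimately show ?thesis by blast
qed

lemma prob_missing_ge:
  assumes "\<Lambda> \<subseteq> {0..} \<times> {0..}" "\<exists>s d. (s, d) \<in> \<Lambda> \<and> even d"
  shows "\<exists>c>0. \<forall>\<^sub>F n in sequentially. c \<le> prob_Pow {0..int n} (\<lambda>S. missing n S \<in> \<Lambda>)"
proof -
  obtain s d where sd: "(s, d) \<in> \<Lambda>" "even d" "s \<ge> 0" "d \<ge> 0" using assms by auto
  then obtain e where "d = 2 * e" by (auto elim: evenE)
  with sd have sd': "(int (nat s), 2 * int (nat e)) \<in> \<Lambda>" by simp
  obtain c where c: "c > 0" "\<forall>\<^sub>F n in sequentially.
      c \<le> prob_Pow {0..int n} (\<lambda>S. missing n S = (int (nat s), 2 * int (nat e)))"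
    using prob_missing_eq_ge by blast
  from c(2) have "\<forall>\<^sub>F n in sequentially. c \<le> prob_Pow {0..int n} (\<lambda>S. missing n S \<in> \<Lambda>)"
  proof eventually_elim
    case (elim n)
    also have "prob_Pow {0..int n} (\<lambda>S. missing n S = (int (nat s), 2 * int (nat e)))
        \<le> prob_Pow {0..int n} (\<lambda>S. missing n S \<in> \<Lambda>)"
      using sd' by (intro prob_Pow_mono) auto
    finally show ?case .
  qed
  with c(1) show ?thesis by blast
qed

text \<open>The fringe event is independent of the middle part, and the fringe adds between 0 and
  \<open>2 * K\<close> elements to it. The joint probability thus lies between two products whose
  second factors both tend to \<Phi>. The difference form avoids dividing by the probability of the
  fringe event.\<close>

lemma card_fringe_tendsto:
  fixes K :: nat and t :: real and \<Lambda>
  defines "\<Phi> \<equiv> cdf std_normal_distribution t"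
    and "small \<equiv> \<lambda>n S. real (card S) < (real n + t * sqrt (real n)) / 2"
  shows "(\<lambda>n. prob_Pow {0..int n} (\<lambda>S. small n S \<and> fringe_missing n (int K) S \<in> \<Lambda>)
            - \<Phi> * prob_Pow {0..int n} (\<lambda>S. fringe_missing n (int K) S \<in> \<Lambda>)) \<longlonglongrightarrow> 0"
proof (rule Lim_null_comparison)
  let ?Fr = "\<lambda>n. {0..<int K} \<union> {int n - int K<..int n}" and ?Mid = "\<lambda>n. {int K..int n - int K}"
  let ?P = "\<lambda>n c. prob_Pow (?Mid n) (\<lambda>T. real (card T) + c < (real n + t * sqrt (real n)) / 2)"
  have "(\<lambda>n. \<bar>?P n (2 * real K) - \<Phi>\<bar> + \<bar>?P n 0 - \<Phi>\<bar>) \<longlonglongrightarrow> \<bar>\<Phi> - \<Phi>\<bar> + \<bar>\<Phi> - \<Phi>\<bar>"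
    unfolding \<Phi>_def by (intro tendsto_intros middle_card_tendsto)
  then show "(\<lambda>n. \<bar>?P n (2 * real K) - \<Phi>\<bar> + \<bar>?P n 0 - \<Phi>\<bar>) \<longlonglongrightarrow> 0" by simp
  show "\<forall>\<^sub>F n in sequentially.
    norm (prob_Pow {0..int n} (\<lambda>S. small n S \<and> fringe_missing n (int K) S \<in> \<Lambda>)
        - \<Phi> * prob_Pow {0..int n} (\<lambda>S. fringe_missing n (int K) S \<in> \<Lambda>))
      \<le> \<bar>?P n (2 * real K) - \<Phi>\<bar> + \<bar>?P n 0 - \<Phi>\<bar>"
    using eventually_ge_at_top[of "2 * K"]
  proof eventually_elim
    case (elim n)
    let ?G = "\<lambda>S. fringe_missing n (int K) S \<in> \<Lambda>" and ?p = "prob_Pow (?Fr n) (\<lambda>S. fringe_missing n (int K) S \<in> \<Lambda>)"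
    have U: "?Fr n \<union> ?Mid n = {0..int n}" "?Fr n \<inter> ?Mid n = {}" using elim by auto
    have G: "?G S \<longleftrightarrow> ?G (S \<inter> ?Fr n)" if "S \<subseteq> {0..int n}" for S
    proof -
      have "fringe_missing n (int K) S = fringe_missing n (int K) (S \<inter> ?Fr n)"
        using that by (intro fringe_missing_cong) auto
      then show ?thesis by simp
    qed
    have indep: "prob_Pow {0..int n} (\<lambda>S. ?G S \<and> Q (S \<inter> ?Mid n)) = ?p * prob_Pow (?Mid n) Q" for Q
    proof -
      have "prob_Pow {0..int n} (\<lambda>S. ?G S \<and> Q (S \<inter> ?Mid n))
          = prob_Pow (?Fr n \<union> ?Mid n) (\<lambda>S. ?G (S \<inter> ?Fr n) \<and> Q (S \<inter> ?Mid n))"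
        unfolding U(1) using G by (intro prob_Pow_cong) auto
      also have "\<dots> = ?p * prob_Pow (?Mid n) Q"
        using U(2) by (intro prob_Pow_Un) auto
      finally show ?thesis .
    qed
    have p: "prob_Pow {0..int n} ?G = ?p" using indep[of "\<lambda>_. True"] by simp
    have card: "card (S \<inter> ?Mid n) \<le> card S" "card S \<le> card (S \<inter> ?Mid n) + 2 * K" if "S \<subseteq> {0..int n}" for S
    proof -
      have fin: "finite S" using that finite_subset by blast
      then show "card (S \<inter> ?Mid n) \<le> card S" by (intro card_mono) auto
      have "S = (S \<inter> ?Mid n) \<union> (S \<inter> ?Fr n)" using that unfolding U(1)[symmetric] by blast
      then have "card S \<le> card (S \<inter> ?Mid n) + card (S \<inter> ?Fr n)" by (metis card_Un_le)
      also have "card (S \<inter> ?Fr n) \<le> card (?Fr n)" by (intro card_mono) auto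
      also have "card (?Fr n) \<le> 2 * K" by (rule order_trans[OF card_Un_le]) simp
      finally show "card S \<le> card (S \<inter> ?Mid n) + 2 * K" by simp
    qed
    have "prob_Pow {0..int n} (\<lambda>S. small n S \<and> ?G S) \<le> ?p * ?P n 0"
      unfolding indep[symmetric]
    proof (rule prob_Pow_mono)
      fix S assume "S \<subseteq> {0..int n}" "small n S \<and> ?G S"
      then show "?G S \<and> real (card (S \<inter> ?Mid n)) + 0 < (real n + t * sqrt (real n)) / 2"
        using card(1)[of S] by (auto simp: small_def)
    qed simp
    moreover have "?p * ?P n (2 * real K) \<le> prob_Pow {0..int n} (\<lambda>S. small n S \<and> ?G S)"
      unfolding indep[symmetric]
    proof (rule prob_Pow_mono)
      fix S assume "S \<subseteq> {0..int n}" "?G S \<and> real (card (S \<inter> ?Mid n)) + 2 * real K < (real n + t * sqrt (real n)) / 2"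
      then show "small n S \<and> ?G S"
        using card(2)[of S] by (auto simp: small_def)
    qed simp
    moreover have "\<bar>?p * x - \<Phi> * ?p\<bar> \<le> \<bar>x - \<Phi>\<bar>" for x
    proof -
      have "\<bar>?p * x - \<Phi> * ?p\<bar> = ?p * \<bar>x - \<Phi>\<bar>"
        by (simp add: abs_mult right_diff_distrib[symmetric] mult.commute[of \<Phi>])
      also have "\<dots> \<le> 1 * \<bar>x - \<Phi>\<bar>" by (intro mult_right_mono) auto
      finally show ?thesis by simp
    qed
    note this[of "?P n 0"] this[of "?P n (2 * real K)"]
    ultimately show ?case unfolding p real_norm_def by linarith
  qed
qed

theorem proposition5p7:
  fixes \<Lambda> :: "(int \<times> int) set" and t :: real
  assumes "\<Lambda> \<subseteq> {0..} \<times> {0..}"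
    and "\<exists>s d. (s, d) \<in> \<Lambda> \<and> even d"
  shows "(\<lambda>n::nat. \<P>(S in measure_pmf (uniform_subset n).
            real (card S) < (real n + t * sqrt (real n)) / 2 \<bar> missing n S \<in> \<Lambda>))
         \<longlonglongrightarrow> cdf std_normal_distribution t"
proof -
  let ?\<Phi> = "cdf std_normal_distribution t"
  let ?small = "\<lambda>n S. real (card S) < (real n + t * sqrt (real n)) / 2"
  let ?AB = "\<lambda>n. prob_Pow {0..int n} (\<lambda>S. ?small n S \<and> missing n S \<in> \<Lambda>)"
  let ?B = "\<lambda>n. prob_Pow {0..int n} (\<lambda>S. missing n S \<in> \<Lambda>)"
  interpret N: real_distribution std_normal_distribution by (rule real_dist_normal_dist)
  have \<Phi>: "0 \<le> ?\<Phi>" "?\<Phi> \<le> 1" by (auto simp: N.cdf_nonneg N.cdf_bounded_prob)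
  \<comment> \<open>Replacing \<open>missing\<close> by \<open>fringe_missing\<close> costs at most
    \<open>r / 4\<close> in each of the two terms, because \<Phi> is at most 1; the fringe version
    contributes less than \<open>r / 2\<close>.\<close>
  have lim: "(\<lambda>n. ?AB n - ?\<Phi> * ?B n) \<longlonglongrightarrow> 0"
  proof (rule LIMSEQ_I)
    fix r :: real assume "r > 0"
    then obtain K where K: "\<And>p q. prob_Pow {p..q} (\<lambda>S. \<not> full p q (int K) S) \<le> r / 4"
      using prob_not_full_small[of "r / 4"] by auto
    let ?AF = "\<lambda>n. prob_Pow {0..int n} (\<lambda>S. ?small n S \<and> fringe_missing n (int K) S \<in> \<Lambda>)"
    let ?F = "\<lambda>n. prob_Pow {0..int n} (\<lambda>S. fringe_missing n (int K) S \<in> \<Lambda>)"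
    have "\<forall>\<^sub>F n in sequentially. \<bar>?AF n - ?\<Phi> * ?F n\<bar> < r / 2"
      using card_fringe_tendsto[of t K \<Lambda>, unfolded tendsto_iff, rule_format, of "r / 2"] \<open>r > 0\<close>
      by (simp add: dist_real_def)
    then have "\<forall>\<^sub>F n in sequentially. norm (?AB n - ?\<Phi> * ?B n - 0) < r"
      using eventually_ge_at_top[of K]
    proof eventually_elim
      case (elim n)
      have close: "\<bar>prob_Pow {0..int n} (\<lambda>S. Q S \<and> missing n S \<in> \<Lambda>)
          - prob_Pow {0..int n} (\<lambda>S. Q S \<and> fringe_missing n (int K) S \<in> \<Lambda>)\<bar> \<le> r / 4" for Q
      proof -
        have eq: "missing n S = fringe_missing n (int K) S"
          if "S \<subseteq> {0..int n}" "full 0 (int n) (int K) S" for S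
          using that elim by (intro missing_eq_fringe_missing) auto
        let ?nf = "\<lambda>S. \<not> full 0 (int n) (int K) S"
        have "prob_Pow {0..int n} (\<lambda>S. Q S \<and> missing n S \<in> \<Lambda>)
            \<le> prob_Pow {0..int n} (\<lambda>S. (Q S \<and> fringe_missing n (int K) S \<in> \<Lambda>) \<or> ?nf S)"
          using eq by (intro prob_Pow_mono) auto
        moreover have "prob_Pow {0..int n} (\<lambda>S. Q S \<and> fringe_missing n (int K) S \<in> \<Lambda>)
            \<le> prob_Pow {0..int n} (\<lambda>S. (Q S \<and> missing n S \<in> \<Lambda>) \<or> ?nf S)"
          using eq by (intro prob_Pow_mono) auto
        moreover note prob_Pow_disj_le[of "{0..int n}" "\<lambda>S. Q S \<and> missing n S \<in> \<Lambda>" ?nf]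
          prob_Pow_disj_le[of "{0..int n}" "\<lambda>S. Q S \<and> fringe_missing n (int K) S \<in> \<Lambda>" ?nf]
          K[of 0 "int n"]
        ultimately show ?thesis by linarith
      qed
      have "\<bar>?\<Phi> * (?B n - ?F n)\<bar> \<le> 1 * (r / 4)"
        unfolding abs_mult using close[of "\<lambda>_. True"] \<Phi> by (intro mult_mono) auto
      moreover have "?\<Phi> * (?B n - ?F n) = ?\<Phi> * ?B n - ?\<Phi> * ?F n" by (simp add: right_diff_distrib)
      moreover note close[of "?small n"] elim(1)
      ultimately show ?case unfolding real_norm_def by linarith
    qed
    then show "\<exists>no. \<forall>n\<ge>no. norm (?AB n - ?\<Phi> * ?B n - 0) < r"
      by (simp add: eventually_sequentially)
  qed
  \<comment> \<open>The lower bound \<open>c\<close> makes division by \<open>?B n\<close> harmless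
    in the limit.\<close>
  obtain c where c: "c > 0" "\<forall>\<^sub>F n in sequentially. c \<le> ?B n"
    using prob_missing_ge[OF assms] by blast
  have "(\<lambda>n. (?AB n - ?\<Phi> * ?B n) / ?B n) \<longlonglongrightarrow> 0"
  proof (rule Lim_null_comparison)
    show "(\<lambda>n. \<bar>?AB n - ?\<Phi> * ?B n\<bar> / c) \<longlonglongrightarrow> 0"
      using tendsto_divide[OF tendsto_rabs_zero[OF lim] tendsto_const[of c]] c(1) by simp
    show "\<forall>\<^sub>F n in sequentially. norm ((?AB n - ?\<Phi> * ?B n) / ?B n) \<le> \<bar>?AB n - ?\<Phi> * ?B n\<bar> / c"
      using c(2)
    proof eventually_elim
      case (elim n)
      then have "\<bar>?AB n - ?\<Phi> * ?B n\<bar> / ?B n \<le> \<bar>?AB n - ?\<Phi> * ?B n\<bar> / c"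
        using c(1) by (intro divide_left_mono) auto
      moreover have "\<bar>?B n\<bar> = ?B n" by simp
      ultimately show ?case unfolding real_norm_def abs_divide by (simp only:)
    qed
  qed
  from tendsto_add[OF this tendsto_const[of ?\<Phi>]]
  have "(\<lambda>n. (?AB n - ?\<Phi> * ?B n) / ?B n + ?\<Phi>) \<longlonglongrightarrow> ?\<Phi>" by simp
  \<comment> \<open>The identity needs \<open>?B n\<close> to be nonzero: otherwise division by zero
    would make the conditional probability 0 and the left side \<Phi>.\<close>
  moreover have "\<forall>\<^sub>F n in sequentially. (?AB n - ?\<Phi> * ?B n) / ?B n + ?\<Phi>
      = \<P>(S in measure_pmf (uniform_subset n). ?small n S \<bar> missing n S \<in> \<Lambda>)"
    using c(2)
  proof eventually_elim
    case (elim n)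
    then have "?B n \<noteq> 0" using c(1) by linarith
    then show ?case by (simp add: cond_prob_def uniform_subset_def diff_divide_distrib)
  qed
  ultimately show ?thesis by (rule Lim_transform_eventually)
qed

end
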